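(* For every integer $n\geq 0$, $\bar{p}(40n+35)\equiv 0 \pmod{5}$.
   Context: An overpartition of a positive integer $n$ is a partition of $n$ in which the first occurrence of each distinct part may be overlined; $\bar{p}(n)$ is the number of overpartitions of $n$ for $n\geq 1$, and $\bar{p}(0)=1$. Equivalently, $\sum_{n\geq 0}\bar{p}(n)q^n=\prod_{k\geq 1}\frac{1+q^k}{1-q^k}$. *)

theory Defs
  imports Main "HOL-Library.Multiset"
begin

text \<open>A partition of n: a multiset of positive integers summing to n.
An overpartition of n: a partition M of n together with the set S of those
distinct parts whose first occurrence is overlined (S is any subset of the
set of distinct parts of M).\<close>

definition overpartitions :: "nat \<Rightarrow> (nat multiset \<times> nat set) set" where
  "overpartitions n = {(M, S). (\<forall>k \<in># M. k > 0) \<and> sum_mset M = n \<and> S \<subseteq> set_mset M}"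

definition overpartition_count :: "nat \<Rightarrow> nat" where
  "overpartition_count n = card (overpartitions n)"

end

theory Submission
  imports Defs "HOL-Computational_Algebra.Formal_Power_Series"
begin

text \<open>Let \<open>P\<close> be the generating function of overpartitions and \<open>\<theta> = \<Sum>x\<in>\<int>. (-1)\<^sup>x q\<^bsup>x\<^sup>2\<^esup>\<close>. By Gauss,
  \<open>P \<theta> = 1\<close>, so modulo 5 we have \<open>P(q) \<theta>(q\<^sup>5) \<equiv> P \<theta>\<^sup>5 = \<theta>\<^sup>4\<close>. The coefficient of \<open>q\<^sup>n\<close> in \<open>\<theta>\<^sup>4\<close> is
  \<open>(-1)\<^sup>n r\<^sub>4(n)\<close>, and \<open>r\<^sub>4(5n) \<equiv> r\<^sub>4(n)\<close>: the six quaternions \<open>1 \<plusminus> 2i\<close>, \<open>1 \<plusminus> 2j\<close>, \<open>1 \<plusminus> 2k\<close> each divide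
  exactly \<open>r\<^sub>4(n)\<close> integral quaternions of norm \<open>5n\<close> on the left, and every quaternion of norm \<open>5n\<close> is
  divisible by either one or all six of them. Extracting the exponents divisible by 5 gives
  \<open>(\<Sum>n. p(5n) q\<^sup>n) \<theta> \<equiv> \<theta>\<^sup>4\<close>, that is, \<open>p(5n) \<equiv> (-1)\<^sup>n r\<^sub>3(n)\<close>. Finally \<open>r\<^sub>3(8n + 7) = 0\<close>.\<close>

unbundle fps_syntax

section \<open>A finite form of Gauss's identity\<close>

text \<open>In the style of Shanks: if \<open>Q n\<close> is the product of \<open>(1 + q\<^sup>k) / (1 - q\<^sup>k)\<close> over \<open>1 \<le> k \<le> n\<close>, then
  \<open>Q n\<close> times the truncated theta series is \<open>gauss_tail Q n (q\<^bsup>n+1\<^esup>)\<close>, which is \<open>1 + O(q\<^bsup>n+1\<^esup>)\<close>.\<close>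

definition gauss_tail :: "(nat \<Rightarrow> 'a :: comm_ring_1) \<Rightarrow> nat \<Rightarrow> 'a \<Rightarrow> 'a" where
  "gauss_tail Q m z = Q 0 + (\<Sum>s<m. (-1) ^ Suc s * z ^ Suc s * (Q (Suc s) + Q s))"

context
  fixes q :: "'a :: idom" and Q :: "nat \<Rightarrow> 'a"
  assumes Q_rec: "\<And>k. (1 - q ^ Suc k) * Q (Suc k) = (1 + q ^ Suc k) * Q k"
begin

text \<open>With \<open>x = q ^ Suc m\<close>, the recurrence gives
  \<open>(1 - x) * (Q (Suc m) + Q m) = 2 * Q m\<close> and
  \<open>(1 + x) * (Q (Suc m) + Q m) = 2 * Q (Suc m)\<close>, so each new summand only moves the
  boundary term from \<open>m\<close> to \<open>Suc m\<close>.\<close>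

lemma gauss_tail_telescope:
  "(1 - q ^ n) * gauss_tail Q m (q ^ Suc n) - (1 + q ^ n) * gauss_tail Q m (q ^ n)
     = - 2 * (-1) ^ m * q ^ (Suc m * n) * Q m"
proof (induction m)
  case 0
  show ?case by (simp add: gauss_tail_def algebra_simps)
next
  case (Suc m)
  define x where "x = q ^ Suc m"
  define y where "y = q ^ n"
  define w where "w = q ^ (Suc m * n)"
  define e :: 'a where "e = (-1) ^ m"
  have rec: "(1 - x) * Q (Suc m) = (1 + x) * Q m"
    using Q_rec[of m] by (simp add: x_def)
  have p1: "(q ^ Suc n) ^ Suc m = x * w"
    unfolding x_def w_def by (metis mult.commute mult_Suc power_add power_mult)
  have p2: "(q ^ n) ^ Suc m = w"
    unfolding w_def by (metis mult.commute power_mult)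
  have p3: "q ^ (Suc (Suc m) * n) = y * w"
    unfolding y_def w_def by (simp add: power_add)
  have IH: "(1 - y) * gauss_tail Q m (q ^ Suc n) - (1 + y) * gauss_tail Q m (q ^ n) = - 2 * e * w * Q m"
    using Suc.IH unfolding y_def w_def e_def .
  have g1: "gauss_tail Q (Suc m) (q ^ Suc n) = gauss_tail Q m (q ^ Suc n) - e * (x * w) * (Q (Suc m) + Q m)"
    unfolding gauss_tail_def sum.lessThan_Suc p1 e_def by simp
  have g2: "gauss_tail Q (Suc m) (q ^ n) = gauss_tail Q m (q ^ n) - e * w * (Q (Suc m) + Q m)"
    unfolding gauss_tail_def sum.lessThan_Suc p2 e_def by simp
  have "(1 - y) * gauss_tail Q (Suc m) (q ^ Suc n) - (1 + y) * gauss_tail Q (Suc m) (q ^ n)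
        = 2 * e * (y * w) * Q (Suc m)"
    unfolding g1 g2 using IH rec by algebra
  then show ?case
    unfolding p3 y_def[symmetric] e_def by simp
qed

lemma finite_gauss_identity:
  assumes nz: "\<And>k. 1 - q ^ Suc k \<noteq> 0"
  shows "(1 + 2 * (\<Sum>j<n. (-1) ^ Suc j * q ^ (Suc j)\<^sup>2)) * Q n = gauss_tail Q n (q ^ Suc n)"
proof (induction n)
  case 0
  show ?case by (simp add: gauss_tail_def)
next
  case (Suc n)
  define x where "x = q ^ Suc n"
  define w where "w = q ^ (Suc n)\<^sup>2"
  define e :: 'a where "e = (-1) ^ n"
  define S where "S = (1 + 2 * (\<Sum>j<n. (-1) ^ Suc j * q ^ (Suc j)\<^sup>2))"
  have rec: "(1 - x) * Q (Suc n) = (1 + x) * Q n"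
    using Q_rec[of n] by (simp add: x_def)
  have p1: "q ^ (Suc (Suc n) * Suc n) = x * w"
    unfolding x_def w_def power2_eq_square by (simp add: power_add)
  have p2: "(q ^ Suc n) ^ Suc n = w"
    unfolding w_def by (metis power2_eq_square power_mult)
  have IH: "S * Q n = gauss_tail Q n x"
    using Suc.IH unfolding S_def x_def .
  have S: "1 + 2 * (\<Sum>j<Suc n. (-1) ^ Suc j * q ^ (Suc j)\<^sup>2) = S - 2 * e * w"
    unfolding S_def e_def w_def by (simp add: algebra_simps)
  have g: "gauss_tail Q (Suc n) x = gauss_tail Q n x - e * w * (Q (Suc n) + Q n)"
    unfolding x_def gauss_tail_def sum.lessThan_Suc p2 e_def by simp
  have t: "(1 - x) * gauss_tail Q (Suc n) (q ^ Suc (Suc n)) - (1 + x) * gauss_tail Q (Suc n) x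
      = 2 * e * (x * w) * Q (Suc n)"
    using gauss_tail_telescope[of "Suc n" "Suc n"] unfolding p1 x_def[symmetric] e_def by simp
  \<comment> \<open>The recurrence controls \<open>Q (Suc n)\<close> only through
    \<open>(1 - x) * Q (Suc n)\<close>, so the step is proved after multiplying by
    \<open>1 - x\<close>, which \<open>nz\<close> then cancels.\<close>
  have "(1 - x) * ((S - 2 * e * w) * Q (Suc n)) = (1 - x) * gauss_tail Q (Suc n) (q ^ Suc (Suc n))"
    using t g IH rec by algebra
  moreover have "1 - x \<noteq> 0"
    using nz[of n] unfolding x_def .
  ultimately show ?case
    unfolding S by simp
qed

end


section \<open>Overpartitions with bounded parts\<close>

text \<open>Bounding the parts by \<open>m\<close> keeps the first \<open>m\<close> factors of the
  infinite product, so that the finite identity applies.\<close>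

definition bounded_overpartitions :: "nat \<Rightarrow> nat \<Rightarrow> (nat multiset \<times> nat set) set" where
  "bounded_overpartitions m n = {(M, S) \<in> overpartitions n. \<forall>k \<in># M. k \<le> m}"

lemma mem_bounded_overpartitions:
  "(M, S) \<in> bounded_overpartitions m n \<longleftrightarrow>
     (\<forall>k \<in># M. 0 < k \<and> k \<le> m) \<and> sum_mset M = n \<and> S \<subseteq> set_mset M"
  by (auto simp: bounded_overpartitions_def overpartitions_def)

lemma bounded_overpartitions_0:
  "bounded_overpartitions 0 n = (if n = 0 then {({#}, {})} else {})"
proof -
  have "(M, S) \<in> bounded_overpartitions 0 n \<longleftrightarrow> n = 0 \<and> M = {#} \<and> S = {}" for M S
    unfolding mem_bounded_overpartitions by (cases M) auto
  then show ?thesis by auto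
qed

lemma bounded_overpartitions_eq:
  assumes "n \<le> m"
  shows "bounded_overpartitions m n = overpartitions n"
proof -
  have "k \<le> m" if "k \<in># M" "sum_mset M = n" for k M
    using that assms by (metis dual_order.trans sum_mset.remove le_add1)
  then show ?thesis
    by (auto simp: bounded_overpartitions_def overpartitions_def)
qed

lemma bounded_overpartitions_Suc_less:
  assumes "n < Suc m"
  shows "bounded_overpartitions (Suc m) n = bounded_overpartitions m n"
  using assms by (simp add: bounded_overpartitions_eq)

text \<open>Classify by the part \<open>Suc m\<close>: it is absent, or removing one copy leaves a legal overlining,
  or its only copy is overlined.\<close>

lemma bounded_overpartitions_Suc:
  "bounded_overpartitions (Suc m) (n + Suc m) =
     bounded_overpartitions m (n + Suc m)
     \<union> (\<lambda>(M, S). (add_mset (Suc m) M, S)) ` bounded_overpartitions (Suc m) n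
     \<union> (\<lambda>(M, S). (add_mset (Suc m) M, insert (Suc m) S)) ` bounded_overpartitions m n"
  (is "?L = ?A \<union> ?f ` ?B \<union> ?g ` ?C")
proof (intro equalityI subsetI)
  fix p assume p: "p \<in> ?L"
  obtain M S where pMS: "p = (M, S)" by force
  have M: "\<And>k. k \<in># M \<Longrightarrow> 0 < k \<and> k \<le> Suc m" "sum_mset M = n + Suc m" "S \<subseteq> set_mset M"
    using p unfolding pMS mem_bounded_overpartitions by auto
  show "p \<in> ?A \<union> ?f ` ?B \<union> ?g ` ?C"
  proof (cases "Suc m \<in># M")
    case False
    then have "p \<in> ?A"
      using M unfolding pMS mem_bounded_overpartitions by (metis le_SucE)
    then show ?thesis by blast
  next
    case True
    then obtain N where N: "M = add_mset (Suc m) N"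
      by (metis insert_DiffM)
    show ?thesis
    proof (cases "S \<subseteq> set_mset N")
      case True
      then have "(N, S) \<in> ?B"
        using M unfolding mem_bounded_overpartitions N by auto
      then have "p \<in> ?f ` ?B"
        unfolding pMS N by force
      then show ?thesis by blast
    next
      case False
      then have m: "Suc m \<notin># N" "Suc m \<in> S"
        using M(3) unfolding N by auto
      have le: "k \<le> m" if "k \<in># N" for k
        using that M(1)[of k] m(1) unfolding N by (metis le_SucE union_iff add_mset_add_single)
      have "(N, S - {Suc m}) \<in> ?C"
        using M le unfolding mem_bounded_overpartitions N by auto
      moreover have "p = ?g (N, S - {Suc m})"
        using m unfolding pMS N by auto
      ultimately show ?thesis by blast
    qed
  qed
next
  fix p assume "p \<in> ?A \<union> ?f ` ?B \<union> ?g ` ?C"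
  then consider "p \<in> ?A" | "p \<in> ?f ` ?B" | "p \<in> ?g ` ?C" by blast
  then show "p \<in> ?L"
  proof cases
    case 1
    then show ?thesis
      by (cases p) (auto simp: mem_bounded_overpartitions le_Suc_eq)
  next
    case 2
    then show ?thesis
      by (auto simp: mem_bounded_overpartitions)
  next
    case 3
    then show ?thesis
      by (auto simp: mem_bounded_overpartitions le_Suc_eq)
  qed
qed

text \<open>\<open>card\<close> sends infinite sets to 0, so the counts below rest on finiteness.
  The inner induction on \<open>n\<close> handles the piece that keeps the bound
  \<open>Suc m\<close>.\<close>

lemma finite_bounded_overpartitions: "finite (bounded_overpartitions m n)"
proof (induction m arbitrary: n)
  case 0
  show ?case by (simp add: bounded_overpartitions_0)
next
  case (Suc m)
  show ?case
  proof (induction n rule: less_induct)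
    case (less n)
    show ?case
    proof (cases "n < Suc m")
      case True
      then show ?thesis using Suc.IH by (simp add: bounded_overpartitions_Suc_less)
    next
      case False
      then obtain k where k: "n = k + Suc m"
        by (metis add.commute le_Suc_ex not_less)
      show ?thesis
        unfolding k bounded_overpartitions_Suc using Suc.IH less.IH[of k] k by simp
    qed
  qed
qed

lemma card_bounded_overpartitions_Suc:
  "card (bounded_overpartitions (Suc m) (n + Suc m)) =
     card (bounded_overpartitions m (n + Suc m)) + card (bounded_overpartitions (Suc m) n)
     + card (bounded_overpartitions m n)"
proof -
  let ?f = "\<lambda>(M, S). (add_mset (Suc m) M, S)"
  let ?g = "\<lambda>(M, S). (add_mset (Suc m) M, insert (Suc m) S)"
  let ?A = "bounded_overpartitions m (n + Suc m)"
  let ?B = "bounded_overpartitions (Suc m) n"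
  let ?C = "bounded_overpartitions m n"
  have C: "Suc m \<notin># M \<and> Suc m \<notin> S" if "(M, S) \<in> ?C" for M S
    using that unfolding mem_bounded_overpartitions by (metis Suc_n_not_le_n subsetD)
  have f: "card (?f ` ?B) = card ?B"
    by (intro card_image inj_onI) auto
  have g: "card (?g ` ?C) = card ?C"
  proof (intro card_image inj_onI)
    fix x y assume "x \<in> ?C" "y \<in> ?C" "?g x = ?g y"
    then show "x = y"
      using C by (cases x; cases y) (auto dest!: insert_ident[THEN iffD1, rotated 2])
  qed
  have d1: "?A \<inter> ?f ` ?B = {}" and d2: "?A \<inter> ?g ` ?C = {}"
    by (auto simp: mem_bounded_overpartitions)
  \<comment> \<open>A common element would put \<open>Suc m\<close> into \<open>S\<close>, hence
    into \<open>M = N\<close>, whose parts are at most \<open>m\<close>.\<close>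
  have d3: "?f ` ?B \<inter> ?g ` ?C = {}"
  proof -
    have "?f (M, S) \<noteq> ?g (N, T)" if "(M, S) \<in> ?B" "(N, T) \<in> ?C" for M S N T
    proof
      assume "?f (M, S) = ?g (N, T)"
      then have "M = N" "Suc m \<in> S" by auto
      then have "Suc m \<in># N"
        using that(1) unfolding mem_bounded_overpartitions by auto
      then show False using C[OF that(2)] by simp
    qed
    then show ?thesis by fast
  qed
  have "card (?A \<union> ?f ` ?B \<union> ?g ` ?C) = card (?A \<union> ?f ` ?B) + card (?g ` ?C)"
    using d2 d3 by (intro card_Un_disjoint) (simp_all add: finite_bounded_overpartitions Int_Un_distrib2)
  also have "card (?A \<union> ?f ` ?B) = card ?A + card (?f ` ?B)"
    using d1 by (intro card_Un_disjoint) (simp_all add: finite_bounded_overpartitions)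
  finally show ?thesis
    unfolding bounded_overpartitions_Suc f g .
qed

section \<open>Generating functions of overpartitions\<close>

definition bounded_overpartition_fps :: "nat \<Rightarrow> int fps" where
  "bounded_overpartition_fps m = Abs_fps (\<lambda>n. int (card (bounded_overpartitions m n)))"

definition overpartition_fps :: "int fps" where
  "overpartition_fps = Abs_fps (\<lambda>n. int (overpartition_count n))"

lemma bounded_overpartition_fps_0: "bounded_overpartition_fps 0 = 1"
  by (rule fps_ext) (simp add: bounded_overpartition_fps_def bounded_overpartitions_0)

text \<open>This supplies \<open>Q_rec\<close> with \<open>q = fps_X\<close>. Below exponent
  \<open>Suc m\<close> the shifted terms vanish; from there on the classification by the part
  \<open>Suc m\<close> applies.\<close>

lemma bounded_overpartition_fps_rec:
  "(1 - fps_X ^ Suc m) * bounded_overpartition_fps (Suc m)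
     = (1 + fps_X ^ Suc m) * bounded_overpartition_fps m"
proof (rule fps_ext)
  fix n
  show "((1 - fps_X ^ Suc m) * bounded_overpartition_fps (Suc m)) $ n
     = ((1 + fps_X ^ Suc m) * bounded_overpartition_fps m) $ n"
  proof (cases "n < Suc m")
    case True
    then show ?thesis
      unfolding left_diff_distrib distrib_right fps_sub_nth fps_add_nth fps_X_power_mult_nth
      by (simp add: bounded_overpartition_fps_def bounded_overpartitions_Suc_less)
  next
    case False
    then obtain k where k: "n = k + Suc m"
      by (metis add.commute le_Suc_ex not_less)
    show ?thesis
      using card_bounded_overpartitions_Suc[of m k] False
      unfolding left_diff_distrib distrib_right fps_sub_nth fps_add_nth fps_X_power_mult_nth k
      by (simp add: bounded_overpartition_fps_def)
  qed
qed


section \<open>Signed counting series\<close>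

text \<open>The sign is attached to the exponent, so it is multiplicative and one encoding serves
  all powers of \<open>theta\<close>. For \<open>N = sq\<close> it is the usual sign of theta, since
  an integer and its square have the same parity.\<close>

definition signed_fps :: "('a \<Rightarrow> nat) \<Rightarrow> int fps" where
  "signed_fps N = Abs_fps (\<lambda>n. (-1) ^ n * int (card {x. N x = n}))"

lemma signed_fps_mult:
  fixes N :: "'a \<Rightarrow> nat" and N' :: "'b \<Rightarrow> nat"
  assumes fin: "\<And>n. finite {x. N x = n}" "\<And>n. finite {x. N' x = n}"
  shows "signed_fps N * signed_fps N' = signed_fps (\<lambda>(x, y). N x + N' y)"
proof (rule fps_ext)
  fix n
  have eq: "{z. (case z of (x, y) \<Rightarrow> N x + N' y) = n} = (\<Union>i\<in>{0..n}. {x. N x = i} \<times> {y. N' y = n - i})"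
    by force
  have card: "card {z. (case z of (x, y) \<Rightarrow> N x + N' y) = n}
     = (\<Sum>i=0..n. card {x. N x = i} * card {y. N' y = n - i})"
    unfolding eq by (subst card_UN_disjoint) (auto simp: fin card_cartesian_product)
  have "(signed_fps N * signed_fps N') $ n
     = (\<Sum>i=0..n. (-1) ^ n * int (card {x. N x = i} * card {y. N' y = n - i}))"
    unfolding fps_mult_nth
  proof (rule sum.cong)
    fix i assume "i \<in> {0..n}"
    then have "(-1 :: int) ^ n = (-1) ^ i * (-1) ^ (n - i)"
      by (simp flip: power_add)
    then show "signed_fps N $ i * signed_fps N' $ (n - i)
        = (-1) ^ n * int (card {x. N x = i} * card {y. N' y = n - i})"
      by (simp add: signed_fps_def)
  qed simp
  also have "\<dots> = signed_fps (\<lambda>(x, y). N x + N' y) $ n"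
    unfolding signed_fps_def fps_nth_Abs_fps card by (simp add: sum_distrib_left)
  finally show "(signed_fps N * signed_fps N') $ n = signed_fps (\<lambda>(x, y). N x + N' y) $ n" .
qed

lemma finite_fibre_add:
  fixes N :: "'a \<Rightarrow> nat" and N' :: "'b \<Rightarrow> nat"
  assumes "\<And>n. finite {x. N x = n}" "\<And>n. finite {x. N' x = n}"
  shows "finite {z. (case z of (x, y) \<Rightarrow> N x + N' y) = n}"
proof -
  have "{z. (case z of (x, y) \<Rightarrow> N x + N' y) = n} = (\<Union>i\<in>{0..n}. {x. N x = i} \<times> {y. N' y = n - i})"
    by force
  then show ?thesis using assms by simp
qed

section \<open>The theta series as inverse of the overpartition series\<close>

definition sq :: "int \<Rightarrow> nat" where
  "sq x = nat (x\<^sup>2)"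

lemma int_sq [simp]: "int (sq x) = x\<^sup>2"
  by (simp add: sq_def)

lemma sq_eq_iff: "sq x = k \<longleftrightarrow> x\<^sup>2 = int k"
  by (metis int_sq of_nat_eq_iff)

lemma sq_fibre: "{x. sq x = m\<^sup>2} = {int m, - int m}"
  by (auto simp: sq_eq_iff power2_eq_iff)

lemma sq_fibre_empty:
  assumes "\<And>m. k \<noteq> m\<^sup>2"
  shows "{x. sq x = k} = {}"
proof -
  have "sq x = (nat \<bar>x\<bar>)\<^sup>2" for x
    unfolding sq_eq_iff by simp
  then show ?thesis using assms by auto
qed

lemma finite_sq_fibre: "finite {x. sq x = k}"
  by (cases "\<exists>m. k = m\<^sup>2") (auto simp: sq_fibre sq_fibre_empty)

definition theta :: "int fps" where
  "theta = signed_fps sq"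

text \<open>A nonzero square \<open>k = m ^ 2\<close> has the two roots \<open>m\<close> and
  \<open>- m\<close>, whence the factor 2, and \<open>m \<le> m ^ 2 \<le> n\<close> keeps it within
  the truncation.\<close>

lemma theta_nth_eq_truncation:
  assumes "k \<le> n"
  shows "theta $ k = (1 + 2 * (\<Sum>j<n. (-1) ^ Suc j * fps_X ^ (Suc j)\<^sup>2)) $ k"
proof -
  have c: "((-1) ^ Suc j * fps_X ^ (Suc j)\<^sup>2 :: int fps) $ k = (if k = (Suc j)\<^sup>2 then (-1) ^ Suc j else 0)" for j
  proof -
    have "(-1 :: int fps) ^ Suc j = fps_const ((-1) ^ Suc j)"
      by (simp flip: fps_const_power fps_const_neg)
    then show ?thesis
      by (simp only: fps_mult_left_const_nth fps_X_power_nth) auto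
  qed
  have R: "(1 + 2 * (\<Sum>j<n. (-1) ^ Suc j * fps_X ^ (Suc j)\<^sup>2) :: int fps) $ k
     = (if k = 0 then 1 else 0) + 2 * (\<Sum>j<n. if k = (Suc j)\<^sup>2 then (-1) ^ Suc j else 0)"
    unfolding fps_add_nth numeral_fps_const fps_mult_left_const_nth fps_sum_nth c by simp
  show ?thesis
  proof (cases "\<exists>m. k = m\<^sup>2")
    case False
    then have "k \<noteq> 0" by (metis zero_power2)
    with False show ?thesis
      unfolding R theta_def signed_fps_def by (auto simp: sq_fibre_empty)
  next
    case True
    then obtain m where m: "k = m\<^sup>2" by blast
    show ?thesis
    proof (cases m)
      case 0
      then show ?thesis
        unfolding R theta_def signed_fps_def using m sq_fibre[of 0] by simp
    next
      case (Suc i)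
      have "m \<le> m\<^sup>2" by (simp add: power2_eq_square)
      then have "i < n" using Suc m assms by simp
      have "(\<Sum>j<n. if k = (Suc j)\<^sup>2 then (-1) ^ Suc j else 0) = (\<Sum>j<n. if j = i then (-1) ^ Suc j else (0::int))"
        by (rule sum.cong) (auto simp: m Suc)
      also have "\<dots> = (-1) ^ m"
        using \<open>i < n\<close> Suc by simp
      finally have "(\<Sum>j<n. if k = (Suc j)\<^sup>2 then (-1) ^ Suc j else 0) = (-1 :: int) ^ m" .
      moreover have "(-1 :: int) ^ m\<^sup>2 = (-1) ^ m"
        by (simp add: minus_one_power_iff)
      ultimately show ?thesis
        unfolding R theta_def signed_fps_def using Suc m sq_fibre[of m] by simp
    qed
  qed
qed

text \<open>The coefficient at \<open>n\<close> sees both factors only up to exponent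
  \<open>n\<close>, where they agree with the truncated theta series and
  \<open>?Q n\<close>.\<close>

lemma theta_mult_overpartition_fps: "theta * overpartition_fps = 1"
proof (rule fps_ext)
  fix n
  let ?Q = bounded_overpartition_fps
  let ?S = "1 + 2 * (\<Sum>j<n. (-1) ^ Suc j * fps_X ^ (Suc j)\<^sup>2) :: int fps"
  let ?T = "\<Sum>s<n. (-1) ^ Suc s * (fps_X ^ Suc n) ^ Suc s * (?Q (Suc s) + ?Q s)"
  have "1 - fps_X ^ Suc k \<noteq> (0 :: int fps)" for k
  proof
    assume "1 - fps_X ^ Suc k = (0 :: int fps)"
    then have "(1 - fps_X ^ Suc k :: int fps) $ 0 = 0 $ 0" by (rule arg_cong)
    then show False by simp
  qed
  then have id: "?S * ?Q n = 1 + ?T"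
    using finite_gauss_identity[OF bounded_overpartition_fps_rec, of n]
    unfolding gauss_tail_def bounded_overpartition_fps_0 by blast
  \<comment> \<open>One factor \<open>fps_X ^ Suc n\<close> comes out of every summand, so the tail
    starts beyond exponent \<open>n\<close>.\<close>
  have "?T = fps_X ^ Suc n * (\<Sum>s<n. (-1) ^ Suc s * (fps_X ^ Suc n) ^ s * (?Q (Suc s) + ?Q s))"
    unfolding sum_distrib_left by (rule sum.cong) (simp_all only: power_Suc[of "fps_X ^ Suc n"] ac_simps)
  then have T: "?T $ n = 0"
    by (simp only: fps_X_power_mult_nth) simp
  have "(theta * overpartition_fps) $ n = (?S * ?Q n) $ n"
    unfolding fps_mult_nth
  proof (rule sum.cong)
    fix i assume "i \<in> {0..n}"
    then have "theta $ i = ?S $ i"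
      by (intro theta_nth_eq_truncation) simp
    moreover have "overpartition_fps $ (n - i) = ?Q n $ (n - i)"
      by (simp add: overpartition_fps_def bounded_overpartition_fps_def
            bounded_overpartitions_eq overpartition_count_def)
    ultimately show "theta $ i * overpartition_fps $ (n - i) = ?S $ i * ?Q n $ (n - i)"
      by (simp only:)
  qed simp
  then show "(theta * overpartition_fps) $ n = 1 $ n"
    unfolding id fps_add_nth T by simp
qed


section \<open>Sums of four squares of multiples of five\<close>

definition norm4 :: "int \<times> int \<times> int \<times> int \<Rightarrow> nat" where
  "norm4 = (\<lambda>(a, b, c, d). sq a + (sq b + (sq c + sq d)))"

definition norm3 :: "int \<times> int \<times> int \<Rightarrow> nat" where
  "norm3 = (\<lambda>(a, b, c). sq a + (sq b + sq c))"

lemma theta_power_3: "theta ^ 3 = signed_fps norm3"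
  and theta_power_4: "theta ^ 4 = signed_fps norm4"
  and finite_norm4_fibre: "finite {x. norm4 x = n}"
proof -
  have f2: "\<And>n. finite {z. (case z of (x, y) \<Rightarrow> sq x + sq y) = n}"
    by (intro finite_fibre_add finite_sq_fibre)
  have f3: "\<And>n. finite {x. norm3 x = n}"
    using finite_fibre_add[OF finite_sq_fibre f2] by (simp add: norm3_def case_prod_unfold)
  show "finite {x. norm4 x = n}"
    using finite_fibre_add[OF finite_sq_fibre f3, of n]
    by (simp add: norm4_def norm3_def case_prod_unfold)
  have 2: "theta * theta = signed_fps (\<lambda>(x, y). sq x + sq y)"
    unfolding theta_def by (intro signed_fps_mult finite_sq_fibre)
  have 3: "theta * (theta * theta) = signed_fps norm3"
    unfolding 2 unfolding theta_def
    by (subst signed_fps_mult) (simp_all add: finite_sq_fibre f2[unfolded case_prod_unfold] norm3_def case_prod_unfold)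
  then show "theta ^ 3 = signed_fps norm3"
    by (simp add: power3_eq_cube mult.assoc)
  have "theta * (theta * (theta * theta)) = signed_fps norm4"
    unfolding 3 unfolding theta_def
    by (subst signed_fps_mult)
       (simp_all add: finite_sq_fibre f3[unfolded norm3_def case_prod_unfold]
          norm4_def norm3_def case_prod_unfold)
  then show "theta ^ 4 = signed_fps norm4"
    by (simp add: power4_eq_xxxx mult.assoc)
qed

text \<open>With \<open>(a, b, c, d)\<close> read as the quaternion \<open>a + bi + cj + dk\<close>, this is divisibility by \<open>1 + 2i\<close>
  on the left. Composing with the norm-preserving maps \<open>rot\<close> (cyclic on \<open>i, j, k\<close>) and \<open>flip\<close>
  (\<open>2i\<close> becomes \<open>-2i\<close>) gives the other five divisors.\<close>

definition divisible_by_1_plus_2i :: "int \<times> int \<times> int \<times> int \<Rightarrow> bool" where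
  "divisible_by_1_plus_2i = (\<lambda>(a, b, c, d). 5 dvd a + 2 * b \<and> 5 dvd c + 2 * d)"

definition rot :: "int \<times> int \<times> int \<times> int \<Rightarrow> int \<times> int \<times> int \<times> int" where
  "rot = (\<lambda>(a, b, c, d). (a, c, d, b))"

definition flip :: "int \<times> int \<times> int \<times> int \<Rightarrow> int \<times> int \<times> int \<times> int" where
  "flip = (\<lambda>(a, b, c, d). (a, - b, c, - d))"

lemma norm4_rot: "norm4 (rot x) = norm4 x"
  by (cases x) (simp add: norm4_def rot_def)

lemma norm4_flip: "norm4 (flip x) = norm4 x"
  by (cases x) (simp add: norm4_def flip_def sq_def)

lemma bij_rot: "bij rot"
  by (rule bij_betw_byWitness[where f' = "rot \<circ> rot"]) (auto simp: rot_def)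

lemma bij_flip: "bij flip"
  by (rule bij_betw_byWitness[where f' = flip]) (auto simp: flip_def)

text \<open>Reduces the count for each of the six divisors to the one for
  \<open>1 + 2i\<close>.\<close>

lemma card_norm4_comp:
  assumes "bij \<sigma>" "\<And>x. norm4 (\<sigma> x) = norm4 x"
  shows "card {x. norm4 x = n \<and> P (\<sigma> x)} = card {x. norm4 x = n \<and> P x}"
proof -
  have *: "\<sigma> ` {x. norm4 x = n \<and> P (\<sigma> x)} = {x. norm4 x = n \<and> P x}"
  proof (intro equalityI subsetI)
    fix y assume y: "y \<in> {x. norm4 x = n \<and> P x}"
    obtain x where "y = \<sigma> x" using \<open>bij \<sigma>\<close> by (metis bij_pointE)
    then show "y \<in> \<sigma> ` {x. norm4 x = n \<and> P (\<sigma> x)}"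
      using y assms(2) by auto
  qed (use assms(2) in auto)
  have "inj_on \<sigma> {x. norm4 x = n \<and> P (\<sigma> x)}"
    using \<open>bij \<sigma>\<close> by (meson bij_is_inj inj_on_subset subset_UNIV)
  from card_image[OF this] show ?thesis unfolding * by simp
qed

lemma norm4_eq_iff: "norm4 (a, b, c, d) = n \<longleftrightarrow> a\<^sup>2 + b\<^sup>2 + c\<^sup>2 + d\<^sup>2 = int n"
proof -
  have "int (norm4 (a, b, c, d)) = a\<^sup>2 + b\<^sup>2 + c\<^sup>2 + d\<^sup>2"
    by (simp add: norm4_def)
  then show ?thesis by (metis of_nat_eq_iff)
qed

lemma card_divisible_by_1_plus_2i: "card {x. norm4 x = 5 * n \<and> divisible_by_1_plus_2i x} = card {x. norm4 x = n}"
proof -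
  \<comment> \<open>Left multiplication by \<open>1 + 2i\<close>, which multiplies the norm by
    5.\<close>
  let ?f = "\<lambda>(a, b, c, d). (a - 2 * b, b + 2 * a, c - 2 * d, d + 2 * c) :: int \<times> int \<times> int \<times> int"
  have "inj_on ?f {x. norm4 x = n}"
    by (rule inj_onI) auto
  note card = card_image[OF this]
  have "?f ` {x. norm4 x = n} = {x. norm4 x = 5 * n \<and> divisible_by_1_plus_2i x}"
  proof (intro equalityI subsetI)
    fix x assume "x \<in> ?f ` {x. norm4 x = n}"
    then obtain y where y: "norm4 y = n" "x = ?f y" by blast
    obtain a b c d where abcd: "y = (a, b, c, d)" by (cases y)
    have x: "x = (a - 2 * b, b + 2 * a, c - 2 * d, d + 2 * c)"
      and n: "a\<^sup>2 + b\<^sup>2 + c\<^sup>2 + d\<^sup>2 = int n"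
      using y unfolding abcd by (simp_all add: norm4_eq_iff)
    have "(a - 2 * b)\<^sup>2 + (b + 2 * a)\<^sup>2 + (c - 2 * d)\<^sup>2 + (d + 2 * c)\<^sup>2 = int (5 * n)"
      using n by (simp add: power2_eq_square algebra_simps)
    then show "x \<in> {x. norm4 x = 5 * n \<and> divisible_by_1_plus_2i x}"
      unfolding x by (simp add: norm4_eq_iff divisible_by_1_plus_2i_def)
  next
    fix x assume "x \<in> {x. norm4 x = 5 * n \<and> divisible_by_1_plus_2i x}"
    then obtain a b c d where x: "x = (a, b, c, d)"
      and n: "a\<^sup>2 + b\<^sup>2 + c\<^sup>2 + d\<^sup>2 = 5 * int n" and D: "5 dvd a + 2 * b" "5 dvd c + 2 * d"
      by (cases x) (auto simp: norm4_eq_iff divisible_by_1_plus_2i_def)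
    obtain u v where u: "a + 2 * b = 5 * u" and v: "c + 2 * d = 5 * v"
      using D by (auto elim!: dvdE)
    \<comment> \<open>The preimage \<open>(1 - 2i) x / 5\<close> has the integral components
      \<open>u\<close>, \<open>b - 2 * u\<close>, \<open>v\<close>,
      \<open>d - 2 * v\<close>.\<close>
    have a: "a = 5 * u - 2 * b" and c: "c = 5 * v - 2 * d" using u v by auto
    have "5 * (u\<^sup>2 + (b - 2 * u)\<^sup>2 + v\<^sup>2 + (d - 2 * v)\<^sup>2) = 5 * int n"
      unfolding n[symmetric] a c by (simp add: power2_eq_square algebra_simps)
    then have "norm4 (u, b - 2 * u, v, d - 2 * v) = n"
      by (simp add: norm4_eq_iff)
    moreover have "x = ?f (u, b - 2 * u, v, d - 2 * v)"
      unfolding x a c by simp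
    ultimately show "x \<in> ?f ` {x. norm4 x = n}" by blast
  qed
  then show ?thesis using card by simp
qed

definition left_divisor_count :: "int \<times> int \<times> int \<times> int \<Rightarrow> nat" where
  "left_divisor_count x =
     of_bool (divisible_by_1_plus_2i x) + of_bool (divisible_by_1_plus_2i (flip x))
     + of_bool (divisible_by_1_plus_2i (rot x)) + of_bool (divisible_by_1_plus_2i (flip (rot x)))
     + of_bool (divisible_by_1_plus_2i (rot (rot x))) + of_bool (divisible_by_1_plus_2i (flip (rot (rot x))))"

text \<open>Each nonzero isotropic vector of \<open>\<bbbF>\<^sub>5\<^sup>4\<close> lies in exactly one of the six totally isotropic planes
  of a ruling of the quadric, the zero vector in all six.\<close>

lemma left_divisor_count_mod_5:
  assumes "5 dvd norm4 x"
  shows "left_divisor_count x mod 5 = 1"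
proof -
  obtain a b c d where x: "x = (a, b, c, d)" by (cases x)
  \<comment> \<open>All 625 residue vectors are checked by evaluation.\<close>
  have key: "\<forall>a\<in>{0,1,2,3,4::int}. \<forall>b\<in>{0,1,2,3,4::int}. \<forall>c\<in>{0,1,2,3,4::int}. \<forall>d\<in>{0,1,2,3,4::int}.
     (a\<^sup>2 + b\<^sup>2 + c\<^sup>2 + d\<^sup>2) mod 5 = 0 \<longrightarrow>
     (of_bool ((a + 2 * b) mod 5 = 0 \<and> (c + 2 * d) mod 5 = 0)
     + of_bool ((a - 2 * b) mod 5 = 0 \<and> (c - 2 * d) mod 5 = 0)
     + of_bool ((a + 2 * c) mod 5 = 0 \<and> (d + 2 * b) mod 5 = 0)
     + of_bool ((a - 2 * c) mod 5 = 0 \<and> (d - 2 * b) mod 5 = 0)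
     + of_bool ((a + 2 * d) mod 5 = 0 \<and> (b + 2 * c) mod 5 = 0)
     + of_bool ((a - 2 * d) mod 5 = 0 \<and> (b - 2 * c) mod 5 = 0)) mod 5 = (1::nat)"
    by code_simp
  have m: "t mod 5 \<in> {0,1,2,3,4}" for t :: int
    using pos_mod_bound[of 5 t] pos_mod_sign[of 5 t] by auto
  have "int 5 dvd int (norm4 x)" using assms by (simp only: of_nat_dvd_iff)
  then have "(a\<^sup>2 + b\<^sup>2 + c\<^sup>2 + d\<^sup>2) mod 5 = 0"
    unfolding x by (simp add: norm4_def add.assoc)
  moreover have "((a mod 5)\<^sup>2 + (b mod 5)\<^sup>2 + (c mod 5)\<^sup>2 + (d mod 5)\<^sup>2) mod 5
      = (a\<^sup>2 + b\<^sup>2 + c\<^sup>2 + d\<^sup>2) mod 5"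
    by (intro mod_add_cong power_mod)
  ultimately have n: "((a mod 5)\<^sup>2 + (b mod 5)\<^sup>2 + (c mod 5)\<^sup>2 + (d mod 5)\<^sup>2) mod 5 = 0"
    by (simp only:)
  have plus: "(s mod 5 + 2 * (t mod 5)) mod 5 = 0 \<longleftrightarrow> 5 dvd s + 2 * t"
    and minus: "(s mod 5 - 2 * (t mod 5)) mod 5 = 0 \<longleftrightarrow> 5 dvd s + 2 * (- t)" for s t :: int
    by presburger+
  show ?thesis
    using key[rule_format, OF m[of a] m[of b] m[of c] m[of d] n]
    unfolding plus minus x left_divisor_count_def divisible_by_1_plus_2i_def rot_def flip_def prod.case .
qed

text \<open>Double counting of pairs of a divisor and a multiple: by divisors the total is
  \<open>6 * ?r\<close>, by multiples it is \<open>card ?X\<close> modulo 5.\<close>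

lemma card_norm4_mult_5:
  "card {x. norm4 x = 5 * n} mod 5 = card {x. norm4 x = n} mod 5"
proof -
  let ?X = "{x. norm4 x = 5 * n}"
  let ?r = "card {x. norm4 x = n}"
  note fin = finite_norm4_fibre[of "5 * n"]
  have count: "(\<Sum>x\<in>?X. of_bool (divisible_by_1_plus_2i (\<sigma> x))) = ?r"
    if "bij \<sigma>" "\<And>x. norm4 (\<sigma> x) = norm4 x" for \<sigma>
  proof -
    have "(\<Sum>x\<in>?X. of_bool (divisible_by_1_plus_2i (\<sigma> x))) = card (?X \<inter> {x. divisible_by_1_plus_2i (\<sigma> x)})"
      using fin by (simp add: sum_of_bool_eq)
    also have "?X \<inter> {x. divisible_by_1_plus_2i (\<sigma> x)} = {x. norm4 x = 5 * n \<and> divisible_by_1_plus_2i (\<sigma> x)}"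
      by auto
    finally show ?thesis
      using card_norm4_comp[OF that] card_divisible_by_1_plus_2i by simp
  qed
  have c1: "(\<Sum>x\<in>?X. of_bool (divisible_by_1_plus_2i x)) = ?r"
    using count[of id] by simp
  have c2: "(\<Sum>x\<in>?X. of_bool (divisible_by_1_plus_2i (flip x))) = ?r"
    using count[OF bij_flip norm4_flip] .
  have c3: "(\<Sum>x\<in>?X. of_bool (divisible_by_1_plus_2i (rot x))) = ?r"
    using count[OF bij_rot norm4_rot] .
  have c4: "(\<Sum>x\<in>?X. of_bool (divisible_by_1_plus_2i (flip (rot x)))) = ?r"
    using count[of "flip \<circ> rot"] by (simp add: bij_comp bij_rot bij_flip norm4_rot norm4_flip)
  have c5: "(\<Sum>x\<in>?X. of_bool (divisible_by_1_plus_2i (rot (rot x)))) = ?r"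
    using count[of "rot \<circ> rot"] by (simp add: bij_comp bij_rot norm4_rot)
  have c6: "(\<Sum>x\<in>?X. of_bool (divisible_by_1_plus_2i (flip (rot (rot x))))) = ?r"
    using count[of "flip \<circ> rot \<circ> rot"]
    by (simp add: bij_comp bij_rot bij_flip norm4_rot norm4_flip)
  have "(\<Sum>x\<in>?X. left_divisor_count x) = 6 * ?r"
    unfolding left_divisor_count_def sum.distrib c1 c2 c3 c4 c5 c6 by simp
  moreover have "(\<Sum>x\<in>?X. left_divisor_count x) mod 5 = (\<Sum>x\<in>?X. left_divisor_count x mod 5) mod 5"
    by (simp add: mod_sum_eq)
  moreover have "(\<Sum>x\<in>?X. left_divisor_count x mod 5) = card ?X"
    by (simp add: left_divisor_count_mod_5)
  moreover have "(6 * k) mod 5 = k mod 5" for k :: nat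
    by presburger
  ultimately show ?thesis by metis
qed


section \<open>Reduction modulo five\<close>

lemma five_dvd_fps_iff: "(5 :: int fps) dvd F \<longleftrightarrow> (\<forall>n. 5 dvd F $ n)"
proof
  assume "5 dvd F"
  then obtain G where "F = fps_const 5 * G"
    by (metis dvdE numeral_fps_const)
  then show "\<forall>n. 5 dvd F $ n" by simp
next
  assume *: "\<forall>n. 5 dvd F $ n"
  have "F = fps_const 5 * Abs_fps (\<lambda>n. F $ n div 5)"
    by (rule fps_ext) (use * in simp)
  then show "5 dvd F"
    by (metis dvd_triv_left numeral_fps_const)
qed

text \<open>This is the substitution of \<open>q ^ 5\<close> for \<open>q\<close>.\<close>

definition spread5 :: "int fps \<Rightarrow> int fps" where
  "spread5 F = Abs_fps (\<lambda>n. if 5 dvd n then F $ (n div 5) else 0)"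

lemma five_dvd_power_5_minus_self: "5 dvd c ^ 5 - (c :: int)"
proof -
  have "c mod 5 \<in> {0,1,2,3,4}"
    using pos_mod_bound[of 5 c] pos_mod_sign[of 5 c] by auto
  then have "(c mod 5) ^ 5 mod 5 = c mod 5" by auto
  then show ?thesis by (simp add: power_mod mod_eq_dvd_iff)
qed

text \<open>Frobenius modulo 5: splitting off the constant term, the fifth power is additive modulo
  5, Fermat treats the constant, and induction treats the shifted series.\<close>

lemma five_dvd_power_5_minus_spread5: "5 dvd F ^ 5 - spread5 F"
proof -
  have "5 dvd (F ^ 5 - spread5 F) $ n" for n
  proof (induction n arbitrary: F rule: less_induct)
    case (less n)
    define c where "c = F $ 0"
    define G where "G = fps_shift 1 F"
    have F: "F = fps_const c + fps_X * G"
    proof (rule fps_ext)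
      fix k show "F $ k = (fps_const c + fps_X * G) $ k"
        by (cases k) (simp_all add: c_def G_def)
    qed
    have sF: "spread5 F = fps_const c + fps_X ^ 5 * spread5 G"
    proof (rule fps_ext)
      fix k
      show "spread5 F $ k = (fps_const c + fps_X ^ 5 * spread5 G) $ k"
      proof (cases "k < 5")
        case True
        then show ?thesis
          by (cases "k = 0") (auto simp: spread5_def c_def fps_X_power_mult_nth dest: dvd_imp_le)
      next
        case False
        then obtain j where "k = j + 5"
          by (metis add.commute le_Suc_ex not_less)
        then show ?thesis
          by (simp add: spread5_def G_def fps_X_power_mult_nth)
      qed
    qed
    \<comment> \<open>\<open>5 * H\<close> collects the mixed terms of the binomial
      expansion.\<close>
    define H where "H = (let a = fps_const c; b = fps_X * G in
      a ^ 4 * b + 2 * a ^ 3 * b ^ 2 + 2 * a ^ 2 * b ^ 3 + a * b ^ 4)"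
    have F5: "F ^ 5 = fps_const c ^ 5 + (fps_X * G) ^ 5 + 5 * H"
      unfolding F H_def Let_def by algebra
    have c5: "fps_const (c ^ 5 - c) = fps_const c ^ 5 - fps_const c" by simp
    have eq: "F ^ 5 - spread5 F = fps_const (c ^ 5 - c) + fps_X ^ 5 * (G ^ 5 - spread5 G) + 5 * H"
      unfolding F5 sF c5 power_mult_distrib by (simp only: right_diff_distrib) simp
    \<comment> \<open>For \<open>n < 5\<close> this coefficient is 0; otherwise it is the one at
      \<open>n - 5\<close> for \<open>G\<close>.\<close>
    have "5 dvd (fps_X ^ 5 * (G ^ 5 - spread5 G)) $ n"
      using less.IH[of "n - 5" G] unfolding fps_X_power_mult_nth by auto
    moreover have "5 dvd fps_const (c ^ 5 - c) $ n"
      using five_dvd_power_5_minus_self by simp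
    moreover have "5 dvd (5 * H) $ n" by (simp add: numeral_fps_const)
    ultimately show ?case
      unfolding eq fps_add_nth by (intro dvd_add)
  qed
  then show ?thesis unfolding five_dvd_fps_iff by blast
qed

text \<open>\<open>spread5 G\<close> has only exponents divisible by 5, so only such exponents of
  \<open>F\<close> contribute at \<open>5 * n\<close>.\<close>

lemma mult_spread5_nth:
  "(F * spread5 G) $ (5 * n) = (Abs_fps (\<lambda>k. F $ (5 * k)) * G) $ n"
proof -
  have "(F * spread5 G) $ (5 * n) = (\<Sum>i=0..5*n. F $ i * spread5 G $ (5 * n - i))"
    by (rule fps_mult_nth)
  also have "\<dots> = (\<Sum>i\<in>(\<lambda>k. 5 * k) ` {0..n}. F $ i * spread5 G $ (5 * n - i))"
  proof (rule sum.mono_neutral_right)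
    show "\<forall>i\<in>{0..5 * n} - (\<lambda>k. 5 * k) ` {0..n}. F $ i * spread5 G $ (5 * n - i) = 0"
    proof
      fix i assume i: "i \<in> {0..5 * n} - (\<lambda>k. 5 * k) ` {0..n}"
      have "\<not> 5 dvd i"
      proof
        assume "5 dvd i"
        then obtain k where "i = 5 * k" ..
        then show False using i by auto
      qed
      then have "\<not> 5 dvd 5 * n - i"
        using i by (metis DiffD1 atLeastAtMost_iff dvd_diffD1 dvd_triv_left)
      then show "F $ i * spread5 G $ (5 * n - i) = 0"
        by (simp add: spread5_def)
    qed
  qed auto
  also have "\<dots> = (\<Sum>k=0..n. F $ (5 * k) * spread5 G $ (5 * n - 5 * k))"
    by (subst sum.reindex) (auto simp: inj_on_def)
  also have "\<dots> = (\<Sum>k=0..n. F $ (5 * k) * G $ (n - k))"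
    by (rule sum.cong) (simp_all add: spread5_def flip: diff_mult_distrib2)
  finally show ?thesis by (simp add: fps_mult_nth)
qed

lemma five_dvd_overpartition_5_minus_theta_cube:
  "5 dvd Abs_fps (\<lambda>k. overpartition_fps $ (5 * k)) - theta ^ 3"
proof -
  let ?P = overpartition_fps
  let ?P5 = "Abs_fps (\<lambda>k. ?P $ (5 * k))"
  have inv: "?P * theta = 1"
    using theta_mult_overpartition_fps by (simp add: mult.commute)
  have "?P * (theta ^ 5 - spread5 theta) = theta ^ 4 - ?P * spread5 theta"
  proof -
    have "?P * theta ^ 5 = (?P * theta) * theta ^ 4"
      by (simp add: eval_nat_numeral ac_simps)
    then show ?thesis unfolding inv by (simp add: right_diff_distrib)
  qed
  then have *: "5 dvd theta ^ 4 - ?P * spread5 theta"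
    by (metis dvd_mult five_dvd_power_5_minus_spread5)
  have "5 dvd (theta ^ 4 - ?P5 * theta) $ n" for n
  proof -
    have "5 dvd (theta ^ 4) $ (5 * n) - (?P5 * theta) $ n"
      using * unfolding five_dvd_fps_iff mult_spread5_nth[symmetric] by simp
    moreover have "5 dvd (theta ^ 4) $ (5 * n) - (theta ^ 4) $ n"
    proof -
      have "5 dvd int (card {x. norm4 x = 5 * n}) - int (card {x. norm4 x = n})"
        using arg_cong[OF card_norm4_mult_5[of n], of int]
        by (simp only: zmod_int of_nat_numeral mod_eq_dvd_iff)
      moreover have "(-1 :: int) ^ (5 * n) = (-1) ^ n"
        by (simp add: minus_one_power_iff)
      ultimately show ?thesis
        unfolding theta_power_4 signed_fps_def by (simp flip: right_diff_distrib)
    qed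
    ultimately have "5 dvd ((theta ^ 4) $ (5 * n) - (?P5 * theta) $ n) - ((theta ^ 4) $ (5 * n) - (theta ^ 4) $ n)"
      by (rule dvd_diff)
    then show ?thesis by simp
  qed
  then have "5 dvd theta ^ 4 - ?P5 * theta"
    unfolding five_dvd_fps_iff by blast
  \<comment> \<open>Since \<open>?P * theta = 1\<close>, multiplying by \<open>- ?P\<close> cancels
    one factor \<open>theta\<close>.\<close>
  then have "5 dvd - ?P * (theta ^ 4 - ?P5 * theta)"
    by (rule dvd_mult)
  also have "- ?P * (theta ^ 4 - ?P5 * theta) = (?P * theta) * (?P5 - theta ^ 3)"
    by (simp add: eval_nat_numeral algebra_simps)
  also have "\<dots> = ?P5 - theta ^ 3"
    unfolding inv by simp
  finally show ?thesis .
qed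

text \<open>Squares are 0, 1 or 4 modulo 8, and no three of these add up to 7 modulo 8.\<close>

lemma norm3_ne_8_mult_add_7: "norm3 x \<noteq> 8 * n + 7"
proof
  assume eq: "norm3 x = 8 * n + 7"
  obtain a b c where x: "x = (a, b, c)" by (cases x)
  have "int (norm3 x) = 8 * int n + 7" unfolding eq by simp
  then have "a\<^sup>2 + b\<^sup>2 + c\<^sup>2 = 8 * int n + 7"
    unfolding x by (simp add: norm3_def)
  moreover have "(8 * k + 7) mod 8 = 7" for k :: int
    by presburger
  moreover have "(a\<^sup>2 mod 8 + b\<^sup>2 mod 8 + c\<^sup>2 mod 8) mod 8 = (a\<^sup>2 + b\<^sup>2 + c\<^sup>2) mod 8"
    by (intro mod_add_cong mod_mod_trivial)
  ultimately have "(a\<^sup>2 mod 8 + b\<^sup>2 mod 8 + c\<^sup>2 mod 8) mod 8 = 7"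
    by (simp only:)
  moreover have "t\<^sup>2 mod 8 \<in> {0, 1, 4}" for t :: int
  proof -
    have "t mod 8 \<in> {0,1,2,3,4,5,6,7}"
      using pos_mod_bound[of 8 t] pos_mod_sign[of 8 t] by auto
    then have "(t mod 8)\<^sup>2 mod 8 \<in> {0, 1, 4}" by auto
    then show ?thesis by (simp add: power_mod)
  qed
  from this[of a] this[of b] this[of c] have "(a\<^sup>2 mod 8 + b\<^sup>2 mod 8 + c\<^sup>2 mod 8) mod 8 \<noteq> 7"
    by auto
  ultimately show False by blast
qed

theorem theorem3p1:
  fixes n :: nat
  shows "overpartition_count (40 * n + 35) mod 5 = 0"
proof -
  have "5 dvd (Abs_fps (\<lambda>k. overpartition_fps $ (5 * k)) - theta ^ 3) $ (8 * n + 7)"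
    using five_dvd_overpartition_5_minus_theta_cube unfolding five_dvd_fps_iff by blast
  moreover have "(theta ^ 3) $ (8 * n + 7) = 0"
    unfolding theta_power_3 signed_fps_def by (simp add: norm3_ne_8_mult_add_7)
  moreover have "5 * (8 * n + 7) = 40 * n + 35" by simp
  ultimately have "5 dvd int (overpartition_count (40 * n + 35))"
    unfolding overpartition_fps_def by simp
  then have "5 dvd overpartition_count (40 * n + 35)"
    by (metis of_nat_dvd_iff of_nat_numeral)
  then show ?thesis by simp
qed

end
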